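(* Let $m_0,\widetilde m_0,\widetilde m_1,\dots,\widetilde m_6$ be complex-valued functions on $\mathbb R^2$, $2\pi$-periodic in each variable. Suppose that for every $\boldsymbol\omega\in S_0$ the matrix $\widetilde{\mathbf M}[:,\widehat0](\boldsymbol\omega)$ has full rank $6$ and $\sum_{i\in\{0,2,4,6\}}m_0(\boldsymbol\omega)\overline{\widetilde m_0(\boldsymbol\omega+\boldsymbol\pi_i)}=1$. Then the vector $\mathbf b_0'(\boldsymbol\omega)$ lies in the column space of $\widetilde{\mathbf M}[:,\widehat0](\boldsymbol\omega)$ for every $\boldsymbol\omega\in S_0$ if and only if, for every $\boldsymbol\omega\in S_0$, $\operatorname{rank}\widetilde{\mathbf M}[\mathrm{odd},\widehat0](\boldsymbol\omega)=\operatorname{rank}\widetilde{\mathbf M}[\mathrm{even},\widehat0](\boldsymbol\omega)=3$ and $[m_0(\boldsymbol\omega),m_0(\boldsymbol\omega+\boldsymbol\pi_2),m_0(\boldsymbol\omega+\boldsymbol\pi_4),m_0(\boldsymbol\omega+\boldsymbol\pi_6)]\,\widetilde{\mathbf M}[\mathrm{even},\widehat0](\boldsymbol\omega)=\mathbf 0$, $[m_0(\boldsymbol\omega+\boldsymbol\pi_1),m_0(\boldsymbol\omega+\boldsymbol\pi_3),m_0(\boldsymbol\omega+\boldsymbol\pi_5),m_0(\boldsymbol\omega+\boldsymbol\pi_7)]\,\widetilde{\mathbf M}[\mathrm{odd},\widehat0](\boldsymbol\omega)=\mathbf 0$.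
   Context: $S_0=[-\pi,\pi)^2$. Shifts: $\boldsymbol\pi_0=(0,0)$, $\boldsymbol\pi_1=(\pi/2,\pi/2)$, $\boldsymbol\pi_2=(\pi,0)$, $\boldsymbol\pi_3=(-\pi/2,\pi/2)$, $\boldsymbol\pi_4=(0,\pi)$, $\boldsymbol\pi_5=(\pi/2,-\pi/2)$, $\boldsymbol\pi_6=(\pi,\pi)$, $\boldsymbol\pi_7=(-\pi/2,-\pi/2)$. $\widetilde{\mathbf M}(\boldsymbol\omega)\in\mathbb C^{8\times7}$ has rows $i=0,\dots,7$, columns $j=0,\dots,6$, $(i,j)$ entry $\overline{\widetilde m_j(\boldsymbol\omega+\boldsymbol\pi_i)}$, except that entries with $j=0$ and $i$ odd are $0$. $\widetilde{\mathbf M}[:,0](\boldsymbol\omega)$ is its column of index $0$; $\widetilde{\mathbf M}[:,\widehat0](\boldsymbol\omega)\in\mathbb C^{8\times6}$ is obtained by deleting that column; $\widetilde{\mathbf M}[\mathrm{even},\widehat0](\boldsymbol\omega)$ and $\widetilde{\mathbf M}[\mathrm{odd},\widehat0](\boldsymbol\omega)\in\mathbb C^{4\times6}$ consist of the rows of $\widetilde{\mathbf M}[:,\widehat0](\boldsymbol\omega)$ with indices $0,2,4,6$ and $1,3,5,7$ respectively (in this order). $\mathbf b_0=(1,0,\dots,0)^\top\in\mathbb R^8$ and $\mathbf b_0'(\boldsymbol\omega)=\mathbf b_0-m_0(\boldsymbol\omega)\,\widetilde{\mathbf M}[:,0](\boldsymbol\omega)$. *)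

theory Defs
  imports "HOL-Analysis.Analysis"
begin

text \<open>Index of an element of a numeral type 'a bit0 (e.g. 8, 6, 4) as a natural number in 0..<CARD.\<close>
definition ix :: "'a::finite bit0 \<Rightarrow> nat" where
  "ix i = nat (Rep_bit0 i)"

text \<open>The domain S_0 = [-pi,pi)^2.\<close>
definition S0 :: "(real \<times> real) set" where
  "S0 = {-pi..<pi} \<times> {-pi..<pi}"

text \<open>The shifts pi_0, ..., pi_7.\<close>
definition shift :: "nat \<Rightarrow> real \<times> real" where
  "shift i = [(0,0), (pi/2,pi/2), (pi,0), (-pi/2,pi/2), (0,pi), (pi/2,-pi/2), (pi,pi), (-pi/2,-pi/2)] ! i"

text \<open>2pi-periodicity in each variable.\<close>
definition periodic2 :: "(real \<times> real \<Rightarrow> complex) \<Rightarrow> bool" where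
  "periodic2 f \<longleftrightarrow> (\<forall>x y. f (x + 2*pi, y) = f (x, y) \<and> f (x, y + 2*pi) = f (x, y))"

text \<open>Entries of the 8x7 matrix M~(omega); mt j is the function m~_j.\<close>
definition Mt_entry :: "(nat \<Rightarrow> real \<times> real \<Rightarrow> complex) \<Rightarrow> real \<times> real \<Rightarrow> nat \<Rightarrow> nat \<Rightarrow> complex" where
  "Mt_entry mt w i j = (if j = 0 \<and> odd i then 0 else cnj (mt j (w + shift i)))"

text \<open>M~[:, hat 0](omega): delete column 0 (8x6).\<close>
definition Mhat :: "(nat \<Rightarrow> real \<times> real \<Rightarrow> complex) \<Rightarrow> real \<times> real \<Rightarrow> complex^6^8" where
  "Mhat mt w = (\<chi> i j. Mt_entry mt w (ix i) (ix j + 1))"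

text \<open>Rows 0,2,4,6 of M~[:, hat 0](omega).\<close>
definition Meven :: "(nat \<Rightarrow> real \<times> real \<Rightarrow> complex) \<Rightarrow> real \<times> real \<Rightarrow> complex^6^4" where
  "Meven mt w = (\<chi> i j. Mt_entry mt w (2 * ix i) (ix j + 1))"

text \<open>Rows 1,3,5,7 of M~[:, hat 0](omega).\<close>
definition Modd :: "(nat \<Rightarrow> real \<times> real \<Rightarrow> complex) \<Rightarrow> real \<times> real \<Rightarrow> complex^6^4" where
  "Modd mt w = (\<chi> i j. Mt_entry mt w (2 * ix i + 1) (ix j + 1))"

text \<open>b_0'(omega) = b_0 - m_0(omega) M~[:,0](omega).\<close>
definition b0' :: "(real \<times> real \<Rightarrow> complex) \<Rightarrow> (nat \<Rightarrow> real \<times> real \<Rightarrow> complex) \<Rightarrow> real \<times> real \<Rightarrow> complex^8" where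
  "b0' m0 mt w = (\<chi> i. (if ix i = 0 then 1 else 0) - m0 w * Mt_entry mt w (ix i) 0)"

end

theory Submission
  imports Defs "HOL-Library.Periodic_Fun"
begin

text \<open>
  Modulo \<open>2\<pi>\<close> the shifts \<open>\<pi>\<^sub>0, \<dots>, \<pi>\<^sub>7\<close> form a group; the even-indexed ones
  form a subgroup and the odd-indexed ones its coset. By periodicity the rows of \<open>M~(\<omega> + \<pi>\<^sub>k)\<close>
  are those of \<open>M~(\<omega>)\<close> permuted by \<open>\<pi>\<^sub>k\<close>, and the normalisation makes \<open>m\<^sub>0\<close> nonzero
  and constant on each coset. So a solution of \<open>M~ x = b\<^sub>0'\<close> at \<open>\<omega> + \<pi>\<^sub>k\<close> gives
  \<open>M~(\<omega>) x\<^sub>k = e\<^sub>k - c\<^sub>k v\<^sub>k\<close>, where \<open>c\<^sub>k v\<^sub>k\<close> depends only on the coset of \<open>k\<close>;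
  combining the \<open>x\<^sub>k\<close> shows that the column space of \<open>M~(\<omega>)\<close> contains the space \<open>W\<close> of
  vectors summing to zero over each coset. Both spaces have dimension \<open>6\<close>, so they coincide,
  i.e. the rows of \<open>M~(\<omega>)\<close> sum to zero over each coset: this is the stated vanishing condition,
  and it forces each block of four rows to have rank at most \<open>3\<close>, hence exactly \<open>3\<close>.
  Conversely, these relations put the column space inside \<open>W\<close>, hence equal to \<open>W\<close>, and
  \<open>b\<^sub>0'(\<omega>) \<in> W\<close> by the normalisation.
\<close>

section \<open>Indices in numeral types\<close>

lemma ix_less: "ix (i::'a::finite bit0) < CARD('a bit0)"
  using Rep_bit0[of i] by (simp add: ix_def nat_less_iff)

lemma of_nat_ix [simp]: "of_nat (ix i) = (i::'a::finite bit0)"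
  using Rep_bit0[of i] by (simp add: ix_def bit0.of_nat_eq Rep_bit0_inverse)

lemma ix_of_nat: "n < CARD('a::finite bit0) \<Longrightarrow> ix (of_nat n :: 'a bit0) = n"
  by (simp add: ix_def bit0.of_nat_eq bit0.Abs_inverse)

lemma ix_numeral [simp]: "numeral n < CARD('a::finite bit0) \<Longrightarrow> ix (numeral n :: 'a bit0) = numeral n"
  using ix_of_nat[of "numeral n", where 'a='a] by simp

lemma ix_0 [simp]: "ix (0 :: 'a::finite bit0) = 0"
  by (simp add: ix_def bit0.Rep_0)

lemma ix_1 [simp]: "ix (1 :: 'a::finite bit0) = 1"
  by (simp add: ix_def bit0.Rep_1)

lemma bit0_in_of_nat_image: "(i::'a::finite bit0) \<in> of_nat ` {..<CARD('a bit0)}"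
  using ix_less[of i] by (intro image_eqI[where x="ix i"]) simp_all

lemma UNIV_eq_4: "(UNIV :: 4 set) = {0, 1, 2, 3}"
proof -
  have "{..<CARD(4)} = {0, 1, 2, 3::nat}" by auto
  then have "i \<in> {0, 1, 2, 3}" for i :: 4
    using bit0_in_of_nat_image[of i] by simp
  then show ?thesis by blast
qed

lemma UNIV_eq_6: "(UNIV :: 6 set) = {0, 1, 2, 3, 4, 5}"
proof -
  have "{..<CARD(6)} = {0, 1, 2, 3, 4, 5::nat}" by auto
  then have "i \<in> {0, 1, 2, 3, 4, 5}" for i :: 6
    using bit0_in_of_nat_image[of i] by simp
  then show ?thesis by blast
qed

lemma UNIV_eq_8: "(UNIV :: 8 set) = {0, 1, 2, 3, 4, 5, 6, 7}"
proof -
  have "{..<CARD(8)} = {0, 1, 2, 3, 4, 5, 6, 7::nat}" by auto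
  then have "i \<in> {0, 1, 2, 3, 4, 5, 6, 7}" for i :: 8
    using bit0_in_of_nat_image[of i] by simp
  then show ?thesis by blast
qed

lemma forall_6: "(\<forall>i::6. P i) \<longleftrightarrow> P 0 \<and> P 1 \<and> P 2 \<and> P 3 \<and> P 4 \<and> P 5"
proof -
  have "(\<forall>i::6. P i) \<longleftrightarrow> (\<forall>i\<in>UNIV. P i)" by simp
  then show ?thesis unfolding UNIV_eq_6 by simp
qed

lemma forall_8:
  "(\<forall>i::8. P i) \<longleftrightarrow> P 0 \<and> P 1 \<and> P 2 \<and> P 3 \<and> P 4 \<and> P 5 \<and> P 6 \<and> P 7"
proof -
  have "(\<forall>i::8. P i) \<longleftrightarrow> (\<forall>i\<in>UNIV. P i)" by simp
  then show ?thesis unfolding UNIV_eq_8 by simp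
qed

lemma sum_UNIV_4: "(\<Sum>i\<in>UNIV. f i) = f 0 + f 1 + f 2 + (f (3::4) :: 'a::comm_monoid_add)"
  unfolding UNIV_eq_4 by (simp add: add.assoc)

lemma sum_UNIV_8:
  "(\<Sum>i\<in>UNIV. f i) = f 0 + f 1 + f 2 + f 3 + f 4 + f 5 + f 6 + (f (7::8) :: 'a::comm_monoid_add)"
  unfolding UNIV_eq_8 by (simp add: add.assoc)

lemma less_8_cases: "(i::nat) < 8 \<Longrightarrow> i \<in> {0, 1, 2, 3, 4, 5, 6, 7}"
  by auto

lemma even_less_8_cases: "(n::nat) < 8 \<Longrightarrow> even n \<Longrightarrow> n \<in> {0, 2, 4, 6}"
  by simp presburger

lemma odd_less_8_cases: "(n::nat) < 8 \<Longrightarrow> odd n \<Longrightarrow> n \<in> {1, 3, 5, 7}"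
  by simp presburger

section \<open>Periodicity and the group of shifts\<close>

definition period_lattice :: "(real \<times> real) set" where
  "period_lattice = {v. fst v / (2*pi) \<in> \<int> \<and> snd v / (2*pi) \<in> \<int>}"

lemma periodic2_period_lattice:
  assumes "periodic2 f" "v \<in> period_lattice"
  shows "f (w + v) = f w"
proof -
  obtain a b :: int where "fst v / (2*pi) = of_int a" "snd v / (2*pi) = of_int b"
    using assms(2) by (auto simp: period_lattice_def elim!: Ints_cases)
  then have v: "v = (of_int a * (2*pi), of_int b * (2*pi))"
    by (simp add: prod_eq_iff divide_eq_eq)
  interpret first: periodic_fun_simple "\<lambda>x. f (x, snd w + of_int b * (2*pi))" "2*pi"
    using assms(1) by unfold_locales (simp add: periodic2_def)
  interpret second: periodic_fun_simple "\<lambda>y. f (fst w, y)" "2*pi"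
    using assms(1) by unfold_locales (simp add: periodic2_def)
  show ?thesis
    using first.plus_of_int[of "fst w" a] second.plus_of_int[of "snd w" b]
    by (cases w) (simp add: v)
qed

lemma add_period_in_S0: "\<exists>v\<in>period_lattice. w + v \<in> S0"
proof -
  have "\<exists>a::int. -pi \<le> x + of_int a * (2*pi) \<and> x + of_int a * (2*pi) < pi" for x
  proof
    define c where "c = (x + pi) / (2*pi)"
    have "x + of_int (- \<lfloor>c\<rfloor>) * (2*pi) = frac c * (2*pi) - pi"
      by (simp add: frac_def c_def field_simps)
    then show "-pi \<le> x + of_int (- \<lfloor>c\<rfloor>) * (2*pi) \<and> x + of_int (- \<lfloor>c\<rfloor>) * (2*pi) < pi"
      using frac_ge_0[of c] frac_lt_1[of c] by simp
  qed
  then obtain a b :: int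
    where "-pi \<le> fst w + of_int a * (2*pi) \<and> fst w + of_int a * (2*pi) < pi"
      and "-pi \<le> snd w + of_int b * (2*pi) \<and> snd w + of_int b * (2*pi) < pi"
    by meson
  then show ?thesis
    by (intro bexI[of _ "(of_int a * (2*pi), of_int b * (2*pi))"])
      (cases w, auto simp: S0_def period_lattice_def)
qed

lemma forall_S0_period_lattice:
  assumes "\<forall>w\<in>S0. P w" "\<And>w v. v \<in> period_lattice \<Longrightarrow> P (w + v) = P w"
  shows "P w"
  using add_period_in_S0[of w] assms by blast

text \<open>\<open>shift_plus k i\<close> is the index of \<open>\<pi>\<^sub>k + \<pi>\<^sub>i\<close> modulo \<open>2\<pi>\<close>
  (\<open>shift_plus_period\<close>), and \<open>shift_neg k\<close> that of \<open>-\<pi>\<^sub>k\<close>.\<close>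

definition shift_plus :: "nat \<Rightarrow> nat \<Rightarrow> nat" where
  "shift_plus k i = [[0, 1, 2, 3, 4, 5, 6, 7], [1, 6, 3, 4, 5, 2, 7, 0], [2, 3, 0, 1, 6, 7, 4, 5],
    [3, 4, 1, 6, 7, 0, 5, 2], [4, 5, 6, 7, 0, 1, 2, 3], [5, 2, 7, 0, 1, 6, 3, 4],
    [6, 7, 4, 5, 2, 3, 0, 1], [7, 0, 5, 2, 3, 4, 1, 6]] ! k ! i"

definition shift_neg :: "nat \<Rightarrow> nat" where
  "shift_neg k = [0, 7, 2, 5, 4, 3, 6, 1] ! k"

lemma shift_plus_period:
  "k < 8 \<Longrightarrow> i < 8 \<Longrightarrow> shift k + shift i - shift (shift_plus k i) \<in> period_lattice"
  by (drule less_8_cases)+ (auto simp: shift_def shift_plus_def period_lattice_def)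

lemma shift_plus_less: "k < 8 \<Longrightarrow> i < 8 \<Longrightarrow> shift_plus k i < 8"
  by (drule less_8_cases)+ (auto simp: shift_plus_def)

lemma even_shift_plus:
  "k < 8 \<Longrightarrow> i < 8 \<Longrightarrow> even (shift_plus k i) \<longleftrightarrow> (even k \<longleftrightarrow> even i)"
  by (drule less_8_cases)+ (auto simp: shift_plus_def)

lemma shift_neg_less: "k < 8 \<Longrightarrow> shift_neg k < 8"
  by (drule less_8_cases) (auto simp: shift_neg_def)

lemma even_shift_neg: "k < 8 \<Longrightarrow> even (shift_neg k) \<longleftrightarrow> even k"
  by (drule less_8_cases) (auto simp: shift_neg_def)

lemma shift_plus_shift_neg: "k < 8 \<Longrightarrow> j < 8 \<Longrightarrow> shift_plus k (shift_plus (shift_neg k) j) = j"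
  by (drule less_8_cases)+ (auto simp: shift_plus_def shift_neg_def)

lemma shift_plus_shift_neg_eq_0_iff:
  "k < 8 \<Longrightarrow> j < 8 \<Longrightarrow> shift_plus (shift_neg k) j = 0 \<longleftrightarrow> j = k"
  by (drule less_8_cases)+ (auto simp: shift_plus_def shift_neg_def)

lemma shift_plus_inverse:
  assumes "k < 8" "j < 8"
  obtains i where "i < 8" "shift_plus k i = j" "i = 0 \<longleftrightarrow> j = k"
    "even i \<longleftrightarrow> (even j \<longleftrightarrow> even k)"
proof (rule that[of "shift_plus (shift_neg k) j"])
  show "shift_plus (shift_neg k) j < 8"
    using assms by (simp add: shift_plus_less shift_neg_less)
  show "even (shift_plus (shift_neg k) j) \<longleftrightarrow> (even j \<longleftrightarrow> even k)"
    using assms by (auto simp: even_shift_plus shift_neg_less even_shift_neg)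
qed (use assms in \<open>simp_all add: shift_plus_shift_neg shift_plus_shift_neg_eq_0_iff\<close>)

lemma bij_betw_shift_plus_even:
  "k \<in> {0, 2, 4, 6} \<Longrightarrow> bij_betw (shift_plus k) {0, 2, 4, 6} {0, 2, 4, 6}"
  by (auto simp: bij_betw_def inj_on_def shift_plus_def)

lemma shift_plus_1_even: "shift_plus 1 ` {0, 2, 4, 6} = {1, 3, 5, 7}"
  by (simp add: shift_plus_def insert_commute)

lemma periodic2_shift_plus:
  assumes "periodic2 f" "k < 8" "i < 8"
  shows "f (w + shift k + shift i) = f (w + shift (shift_plus k i))"
  using periodic2_period_lattice[OF assms(1) shift_plus_period[OF assms(2,3)], of "w + shift (shift_plus k i)"]
  by (simp add: algebra_simps)

definition even_shift_sum :: "(real \<times> real \<Rightarrow> complex) \<Rightarrow> real \<times> real \<Rightarrow> complex" where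
  "even_shift_sum g w = (\<Sum>i\<in>{0, 2, 4, 6}. cnj (g (w + shift i)))"

lemma even_shift_sum_period:
  assumes "periodic2 g" "v \<in> period_lattice"
  shows "even_shift_sum g (w + v) = even_shift_sum g w"
proof -
  have "g (w + v + shift i) = g (w + shift i)" for i
    using periodic2_period_lattice[OF assms, of "w + shift i"] by (simp add: add_ac)
  then show ?thesis
    by (simp add: even_shift_sum_def)
qed

lemma even_shift_sum_shift:
  assumes "periodic2 g" "k \<in> {0, 2, 4, 6}"
  shows "even_shift_sum g (w + shift k) = even_shift_sum g w"
proof -
  have "even_shift_sum g (w + shift k) = (\<Sum>i\<in>{0, 2, 4, 6}. cnj (g (w + shift (shift_plus k i))))"
    unfolding even_shift_sum_def using assms
    by (intro sum.cong refl) (subst periodic2_shift_plus, auto)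
  also have "\<dots> = even_shift_sum g w"
    unfolding even_shift_sum_def
    by (rule sum.reindex_bij_betw[OF bij_betw_shift_plus_even[OF assms(2)], of "\<lambda>i. cnj (g (w + shift i))"])
  finally show ?thesis .
qed

lemma m0_shift_even:
  assumes "\<And>w. m0 w * even_shift_sum g w = 1" "periodic2 g" "k \<in> {0, 2, 4, 6}"
  shows "m0 (w + shift k) = m0 w"
  using assms(1)[of "w + shift k"] assms(1)[of w] even_shift_sum_shift[OF assms(2,3), of w]
  by (metis mult_cancel_right mult_zero_right zero_neq_one)

lemma m0_shift_odd:
  assumes "\<And>w. m0 w * even_shift_sum g w = 1" "periodic2 g" "periodic2 m0" "k \<in> {1, 3, 5, 7}"
  shows "m0 (w + shift k) = m0 (w + shift 1)"
proof -
  obtain i where i: "i \<in> {0, 2, 4, 6}" "shift_plus 1 i = k"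
    using assms(4) shift_plus_1_even by (metis imageE)
  then have "m0 (w + shift k) = m0 (w + shift 1 + shift i)"
    using periodic2_shift_plus[OF assms(3), of 1 i w] by auto
  also have "\<dots> = m0 (w + shift 1)"
    using m0_shift_even[OF assms(1,2) i(1)] .
  finally show ?thesis .
qed

section \<open>Linear algebra\<close>

lemma vec_dim_Un_le: "vec.dim (S \<union> T) \<le> vec.dim S + vec.dim (T :: ('a::field^'n) set)"
proof -
  obtain B where B: "B \<subseteq> S" "vec.independent B" "S \<subseteq> vec.span B" "card B = vec.dim S"
    by (rule vec.basis_exists)
  obtain C where C: "C \<subseteq> T" "vec.independent C" "T \<subseteq> vec.span C" "card C = vec.dim T"
    by (rule vec.basis_exists)
  have "S \<union> T \<subseteq> vec.span (B \<union> C)"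
    using B(3) C(3) vec.span_mono[of B "B \<union> C"] vec.span_mono[of C "B \<union> C"] by blast
  then have "vec.dim (S \<union> T) \<le> card (B \<union> C)"
    using B(2) C(2) by (intro vec.dim_le_card) (auto simp: vec.finiteI_independent)
  also have "\<dots> \<le> card B + card C"
    by (rule card_Un_le)
  finally show ?thesis
    using B(4) C(4) by simp
qed

lemma rows_eq_range: "rows A = range (\<lambda>i. A $ i)"
  by (auto simp: rows_def row_def)

lemma inj_if_rank_eq_ncols:
  fixes A :: "'a::field^'n^'m"
  assumes "rank A = CARD('n)"
  shows "inj ((*v) A)"
proof -
  have "vec.span (rows A) = UNIV"
    using assms by (simp add: row_rank_def_gen flip: vec.dim_eq_full) (simp add: vec.dimension_def card_cart_basis)
  then show ?thesis
    by (simp flip: matrix_left_invertible_injective matrix_left_invertible_span_rows_gen)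
qed

lemma rank_less_if_rows_sum_zero:
  fixes A :: "'a::field^'n^'m"
  assumes "(\<Sum>i\<in>UNIV. A $ i) = 0"
  shows "rank A < CARD('m)"
proof -
  obtain i0 :: 'm where True by simp
  define R where "R = (\<lambda>i. A $ i) ` (UNIV - {i0})"
  have "A $ i0 = - (\<Sum>i\<in>UNIV - {i0}. A $ i)"
    using assms sum.remove[of UNIV i0 "\<lambda>i. A $ i"] by (simp add: eq_neg_iff_add_eq_0)
  also have "\<dots> \<in> vec.span R"
    unfolding R_def by (intro vec.span_neg vec.span_sum vec.span_base) auto
  finally have "A $ i0 \<in> vec.span R" .
  then have "rows A \<subseteq> vec.span R"
    unfolding rows_eq_range R_def by (auto intro: vec.span_base)
  then have "rank A \<le> card R"
    unfolding row_rank_def_gen R_def by (simp add: vec.dim_le_card)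
  also have "\<dots> \<le> card (UNIV - {i0})"
    unfolding R_def by (rule card_image_le) simp
  also have "\<dots> < CARD('m)"
    by (simp add: card_Diff_singleton)
  finally show ?thesis .
qed

lemma const_vector_matrix_mult: "(\<chi> i. c) v* A = c *s (\<Sum>i\<in>UNIV. A $ i)"
  by (simp add: vector_matrix_mult_def vec_eq_iff sum_distrib_left mult.commute)

text \<open>In the next two lemmas \<open>g\<close> identifies \<open>W\<close> with \<open>'a^'n\<close>; this replaces a dimension
  count, since \<open>g \<circ> f\<close> is then an endomorphism of \<open>'a^'n\<close>.\<close>

lemma range_subset_if_subset_range:
  fixes f :: "'a::field^'n \<Rightarrow> 'a^'m" and g :: "'a^'m \<Rightarrow> 'a^'n"
  assumes f: "Vector_Spaces.linear (*s) (*s) f" and g: "Vector_Spaces.linear (*s) (*s) g"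
    and W: "bij_betw g W UNIV" "W \<subseteq> range f"
  shows "range f \<subseteq> W"
proof
  have "surj (g \<circ> f)"
    using W by (force simp: bij_betw_def)
  then have inj: "inj (g \<circ> f)"
    by (intro vec.linear_surj_imp_inj Vector_Spaces.linear_compose[OF f g])
  fix y assume "y \<in> range f"
  then obtain x where x: "y = f x" by blast
  obtain w where w: "w \<in> W" "g w = g (f x)"
    using W(1) by (metis bij_betw_def rangeI imageE)
  then obtain x' where "w = f x'"
    using W(2) by blast
  with w(2) have "x' = x"
    using injD[OF inj, of x' x] by simp
  then show "y \<in> W"
    using w(1) x \<open>w = f x'\<close> by simp
qed

lemma subset_range_if_range_subset:
  fixes f :: "'a::field^'n \<Rightarrow> 'a^'m" and g :: "'a^'m \<Rightarrow> 'a^'n"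
  assumes f: "Vector_Spaces.linear (*s) (*s) f" and g: "Vector_Spaces.linear (*s) (*s) g"
    and W: "bij_betw g W UNIV" "range f \<subseteq> W"
    and "inj f"
  shows "W \<subseteq> range f"
proof
  have "inj_on g (range f)"
    using W inj_on_subset by (auto simp: bij_betw_def)
  with \<open>inj f\<close> have "inj (g \<circ> f)"
    by (rule comp_inj_on)
  then have "surj (g \<circ> f)"
    by (intro vec.linear_inj_imp_surj Vector_Spaces.linear_compose[OF f g])
  fix w assume w: "w \<in> W"
  obtain x where "g (f x) = g w"
    using \<open>surj (g \<circ> f)\<close> by (metis comp_apply surjD)
  then have "f x = w"
    using W w by (auto simp: bij_betw_def dest: inj_onD)
  then show "w \<in> range f" by blast
qed

definition coset_sums_zero :: "('a::comm_monoid_add ^ 8) set" where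
  "coset_sums_zero = {b. b$0 + b$2 + b$4 + b$6 = 0 \<and> b$1 + b$3 + b$5 + b$7 = 0}"

definition take6 :: "'a^8 \<Rightarrow> 'a^6" where
  "take6 b = (\<chi> j. b $ of_nat (ix j))"

lemma linear_take6: "Vector_Spaces.linear (*s) (*s) (take6 :: 'a::field^8 \<Rightarrow> 'a^6)"
  by (simp add: Vector_Spaces.linear_iff vec.vector_space_axioms take6_def vec_eq_iff)

lemma bij_betw_take6: "bij_betw take6 (coset_sums_zero :: ('a::ab_group_add^8) set) UNIV"
proof -
  have "inj_on take6 (coset_sums_zero :: ('a^8) set)"
  proof
    fix b c :: "'a^8"
    assume "b \<in> coset_sums_zero" "c \<in> coset_sums_zero" and "take6 b = take6 c"
    then have bc: "b $ of_nat (ix j) = c $ of_nat (ix j)" for j :: 6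
      by (simp add: take6_def vec_eq_iff)
    have "b$0 = c$0" "b$1 = c$1" "b$2 = c$2" "b$3 = c$3" "b$4 = c$4" "b$5 = c$5"
      using bc[of 0] bc[of 1] bc[of 2] bc[of 3] bc[of 4] bc[of 5] by simp_all
    moreover have "b$6 = c$6" "b$7 = c$7"
      using \<open>b \<in> coset_sums_zero\<close> \<open>c \<in> coset_sums_zero\<close> calculation
      by (simp_all add: coset_sums_zero_def) (metis add_left_cancel)+
    ultimately show "b = c"
      by (simp add: vec_eq_iff forall_8)
  qed
  moreover have "y \<in> take6 ` coset_sums_zero" for y :: "'a^6"
  proof
    let ?b = "\<chi> i::8. if i = 6 then - (y$0 + y$2 + y$4) else if i = 7 then - (y$1 + y$3 + y$5)
      else y $ of_nat (ix i)"
    show "?b \<in> coset_sums_zero"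
      by (simp add: coset_sums_zero_def)
    show "y = take6 ?b"
      by (simp add: take6_def vec_eq_iff forall_6)
  qed
  ultimately show ?thesis
    by (auto simp: bij_betw_def)
qed

lemma matrix_vector_mult_sum4_eq_0_iff:
  fixes A :: "'a::field^'n^'m"
  shows "(\<forall>x. (A *v x)$a + (A *v x)$b + (A *v x)$c + (A *v x)$d = 0) \<longleftrightarrow> A$a + A$b + A$c + A$d = 0"
proof -
  define r where "r = A$a + A$b + A$c + A$d"
  have eq: "(A *v x)$a + (A *v x)$b + (A *v x)$c + (A *v x)$d = (\<Sum>j\<in>UNIV. r$j * x$j)" for x
    by (simp add: r_def matrix_vector_mult_def sum.distrib distrib_right)
  show ?thesis
    unfolding eq r_def[symmetric]
  proof
    assume r: "\<forall>x. (\<Sum>j\<in>UNIV. r$j * x$j) = 0"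
    have "r$k = 0" for k
      using r[rule_format, of "axis k 1"] by (simp add: axis_def if_distrib cong: if_cong)
    then show "r = 0"
      by (simp add: vec_eq_iff)
  qed simp
qed

lemma range_subset_coset_sums_zero_iff:
  fixes A :: "'a::field^'n^8"
  shows "range ((*v) A) \<subseteq> coset_sums_zero
    \<longleftrightarrow> A$0 + A$2 + A$4 + A$6 = 0 \<and> A$1 + A$3 + A$5 + A$7 = 0"
  by (auto simp: coset_sums_zero_def simp flip: matrix_vector_mult_sum4_eq_0_iff)

text \<open>The combination \<open>\<Sum>\<^sub>k b\<^sub>k x\<^sub>k\<close> is a preimage of \<open>b\<close>: the correction terms cancel because \<open>b\<close>
  sums to zero over the even and over the odd indices.\<close>

lemma coset_sums_zero_subset_range:
  fixes A :: "'a::field^'n^8" and x :: "8 \<Rightarrow> 'a^'n"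
  assumes "\<And>k. A *v x k = axis k 1 - (if even (ix k) then \<alpha> *s u else \<beta> *s v)"
  shows "coset_sums_zero \<subseteq> range ((*v) A)"
proof
  fix b :: "'a^8"
  assume "b \<in> coset_sums_zero"
  then have "(b$0 + b$2 + b$4) + b$6 = 0" "(b$1 + b$3 + b$5) + b$7 = 0"
    by (simp_all add: coset_sums_zero_def)
  then have b6: "b$6 = - (b$0 + b$2 + b$4)" and b7: "b$7 = - (b$1 + b$3 + b$5)"
    by (simp_all only: add_eq_0_iff)
  have "A *v (\<Sum>k\<in>UNIV. b$k *s x k)
      = (\<Sum>k\<in>UNIV. b$k *s axis k 1) - (\<Sum>k\<in>UNIV. b$k *s (if even (ix k) then \<alpha> *s u else \<beta> *s v))"
    by (simp add: vec.sum vector_scalar_commute assms vector_ssub_ldistrib sum_subtractf)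
  also have "(\<Sum>k\<in>UNIV. b$k *s (if even (ix k) then \<alpha> *s u else \<beta> *s v)) = 0"
    by (simp add: sum_UNIV_8 vec_eq_iff b6 b7 algebra_simps)
  finally have "A *v (\<Sum>k\<in>UNIV. b$k *s x k) = b"
    by (simp add: basis_expansion)
  then show "b \<in> range ((*v) A)"
    by (metis rangeI)
qed

section \<open>The matrices of the statement\<close>

lemma Mt_entry_period:
  "periodic2 (mt j) \<Longrightarrow> v \<in> period_lattice \<Longrightarrow> Mt_entry mt (w + v) i j = Mt_entry mt w i j"
  using periodic2_period_lattice[of "mt j" v "w + shift i"] by (simp add: Mt_entry_def add_ac)

lemma Mhat_period:
  assumes "\<forall>j\<le>6. periodic2 (mt j)" "v \<in> period_lattice"
  shows "Mhat mt (w + v) = Mhat mt w"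
proof -
  have "ix j + 1 \<le> 6" for j :: 6
    using ix_less[of j] by simp
  then show ?thesis
    using assms by (simp add: Mhat_def vec_eq_iff Mt_entry_period)
qed

lemma b0'_period:
  assumes "periodic2 m0" "periodic2 (mt 0)" "v \<in> period_lattice"
  shows "b0' m0 mt (w + v) = b0' m0 mt w"
  using assms periodic2_period_lattice[OF assms(1,3)] by (simp add: b0'_def vec_eq_iff Mt_entry_period)

lemma Mhat_shift:
  assumes "\<forall>j\<le>6. periodic2 (mt j)" "k < 8"
  shows "Mhat mt (w + shift k) $ i = Mhat mt w $ of_nat (shift_plus k (ix i))"
proof -
  have "ix j + 1 \<le> 6" for j :: 6
    using ix_less[of j] by simp
  moreover have "shift_plus k (ix i) < 8"
    using shift_plus_less[OF assms(2), of "ix i"] ix_less[of i] by simp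
  ultimately show ?thesis
    using assms periodic2_shift_plus[of _ k "ix i" w] ix_less[of i]
    by (simp add: Mhat_def vec_eq_iff Mt_entry_def ix_of_nat)
qed

lemma b0'_shift:
  assumes "periodic2 (mt 0)" "k < 8"
  shows "b0' m0 mt (w + shift k) $ i = (if ix i = 0 then 1 else 0)
    - m0 (w + shift k) * (if odd (ix i) then 0 else cnj (mt 0 (w + shift (shift_plus k (ix i)))))"
  using periodic2_shift_plus[OF assms, of "ix i" w] ix_less[of i] by (simp add: b0'_def Mt_entry_def)

lemma Mhat_solution_at_shift:
  assumes "\<forall>j\<le>6. periodic2 (mt j)" "k < 8" "Mhat mt (w + shift k) *v x = b0' m0 mt (w + shift k)"
  shows "Mhat mt w *v x = axis (of_nat k) 1
    - m0 (w + shift k) *s (\<chi> j. if even (ix j) = even k then cnj (mt 0 (w + shift (ix j))) else 0)"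
proof (subst vec_eq_iff, intro allI)
  fix j :: 8
  obtain i where i: "i < 8" "shift_plus k i = ix j" "i = 0 \<longleftrightarrow> ix j = k"
    "even i \<longleftrightarrow> (even (ix j) \<longleftrightarrow> even k)"
    using shift_plus_inverse[OF assms(2), of "ix j"] ix_less[of j] by auto
  have ix_i: "ix (of_nat i :: 8) = i"
    using i(1) by (simp add: ix_of_nat)
  have "(Mhat mt w *v x) $ j = (Mhat mt (w + shift k) *v x) $ of_nat i"
    using Mhat_shift[OF assms(1,2), of w "of_nat i"] by (simp add: matrix_vector_mult_def ix_i i(2))
  also have "\<dots> = b0' m0 mt (w + shift k) $ of_nat i"
    using assms(3) by simp
  also have "\<dots> = (axis (of_nat k) 1 - m0 (w + shift k) *s
      (\<chi> j. if even (ix j) = even k then cnj (mt 0 (w + shift (ix j))) else 0)) $ j"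
  proof -
    have "j = of_nat k \<longleftrightarrow> ix j = k"
      using assms(2) by (auto simp: ix_of_nat)
    then show ?thesis
      using b0'_shift[OF _ assms(2)] assms(1) i by (simp add: ix_i axis_def)
  qed
  finally show "(Mhat mt w *v x) $ j = (axis (of_nat k) 1 - m0 (w + shift k) *s
      (\<chi> j. if even (ix j) = even k then cnj (mt 0 (w + shift (ix j))) else 0)) $ j" .
qed

lemma range_Mhat_eq_if_solvable_at_shifts:
  assumes "\<forall>j\<le>6. periodic2 (mt j)"
    and m0_even: "\<And>k. k \<in> {0, 2, 4, 6} \<Longrightarrow> m0 (w + shift k) = m0 w"
    and m0_odd: "\<And>k. k \<in> {1, 3, 5, 7} \<Longrightarrow> m0 (w + shift k) = m0 (w + shift 1)"
    and solvable: "\<And>k. k < 8 \<Longrightarrow> \<exists>x. Mhat mt (w + shift k) *v x = b0' m0 mt (w + shift k)"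
  shows "range ((*v) (Mhat mt w)) = coset_sums_zero"
proof -
  obtain xs where xs: "\<And>k. k < 8 \<Longrightarrow> Mhat mt (w + shift k) *v xs k = b0' m0 mt (w + shift k)"
    using solvable by metis
  define c :: "bool \<Rightarrow> complex^8"
    where "c p = (\<chi> j. if even (ix j) = p then cnj (mt 0 (w + shift (ix j))) else 0)" for p
  have "Mhat mt w *v xs (ix k)
      = axis k 1 - (if even (ix k) then m0 w *s c True else m0 (w + shift 1) *s c False)" for k :: 8
  proof -
    have k: "ix k < 8"
      using ix_less[of k] by simp
    have sol: "Mhat mt w *v xs (ix k) = axis k 1 - m0 (w + shift (ix k)) *s c (even (ix k))"
      using Mhat_solution_at_shift[OF assms(1) k xs[OF k]] by (simp add: c_def)
    show ?thesis
    proof (cases "even (ix k)")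
      case True
      with k have "ix k \<in> {0, 2, 4, 6}"
        by (rule even_less_8_cases)
      then show ?thesis
        using sol True m0_even[of "ix k"] by simp
    next
      case False
      with k have "ix k \<in> {1, 3, 5, 7}"
        by (rule odd_less_8_cases)
      then show ?thesis
        using sol False m0_odd[of "ix k"] by simp
    qed
  qed
  then have "coset_sums_zero \<subseteq> range ((*v) (Mhat mt w))"
    by (rule coset_sums_zero_subset_range)
  then show ?thesis
    using range_subset_if_subset_range[OF matrix_vector_mul_linear_gen linear_take6 bij_betw_take6] by blast
qed

lemma b0'_mem_coset_sums_zero:
  assumes "m0 w * even_shift_sum (mt 0) w = 1"
  shows "b0' m0 mt w \<in> coset_sums_zero"
  using assms by (simp add: coset_sums_zero_def b0'_def Mt_entry_def even_shift_sum_def algebra_simps)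

lemma solvable_if_range_subset:
  assumes "rank (Mhat mt w) = 6" "m0 w * even_shift_sum (mt 0) w = 1"
    and "range ((*v) (Mhat mt w)) \<subseteq> coset_sums_zero"
  shows "\<exists>x. Mhat mt w *v x = b0' m0 mt w"
proof -
  have "inj ((*v) (Mhat mt w))"
    using assms(1) by (intro inj_if_rank_eq_ncols) simp
  with assms(3) have "coset_sums_zero \<subseteq> range ((*v) (Mhat mt w))"
    by (intro subset_range_if_range_subset[OF matrix_vector_mul_linear_gen linear_take6 bij_betw_take6])
  then show ?thesis
    using b0'_mem_coset_sums_zero[of m0 w mt, OF assms(2)] by (metis rangeE subsetD)
qed

lemma Meven_nth: "Meven mt w $ i = Mhat mt w $ of_nat (2 * ix i)"
proof -
  have "ix (of_nat (2 * ix i) :: 8) = 2 * ix i"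
    using ix_less[of i] by (intro ix_of_nat) simp
  then show ?thesis
    by (simp add: vec_eq_iff Meven_def Mhat_def del: of_nat_mult)
qed

lemma Modd_nth: "Modd mt w $ i = Mhat mt w $ of_nat (2 * ix i + 1)"
proof -
  have "ix (of_nat (2 * ix i + 1) :: 8) = 2 * ix i + 1"
    using ix_less[of i] by (intro ix_of_nat) simp
  then show ?thesis
    by (simp add: vec_eq_iff Modd_def Mhat_def del: of_nat_mult of_nat_add)
qed

lemma rows_Mhat: "rows (Mhat mt w) = rows (Meven mt w) \<union> rows (Modd mt w)"
  unfolding rows_eq_range UNIV_eq_8 UNIV_eq_4 by (auto simp: Meven_nth Modd_nth)

lemma sum_rows_Meven: "(\<Sum>i\<in>UNIV. Meven mt w $ i) = Mhat mt w $ 0 + Mhat mt w $ 2 + Mhat mt w $ 4 + Mhat mt w $ 6"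
  by (simp add: sum_UNIV_4 Meven_nth)

lemma sum_rows_Modd: "(\<Sum>i\<in>UNIV. Modd mt w $ i) = Mhat mt w $ 1 + Mhat mt w $ 3 + Mhat mt w $ 5 + Mhat mt w $ 7"
  by (simp add: sum_UNIV_4 Modd_nth)

lemma rank_conditions_iff_range_subset:
  assumes rank6: "rank (Mhat mt w) = 6"
    and m0_even: "\<And>k. k \<in> {0, 2, 4, 6} \<Longrightarrow> m0 (w + shift k) = m0 w"
    and m0_odd: "\<And>k. k \<in> {1, 3, 5, 7} \<Longrightarrow> m0 (w + shift k) = m0 (w + shift 1)"
    and "m0 w \<noteq> 0" "m0 (w + shift 1) \<noteq> 0"
  shows "(rank (Modd mt w) = 3 \<and> rank (Meven mt w) = 3
      \<and> (\<chi> i. m0 (w + shift (2 * ix i))) v* Meven mt w = 0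
      \<and> (\<chi> i. m0 (w + shift (2 * ix i + 1))) v* Modd mt w = 0)
    \<longleftrightarrow> range ((*v) (Mhat mt w)) \<subseteq> coset_sums_zero"
proof -
  have "2 * ix i \<in> {0, 2, 4, 6}" for i :: 4
    using ix_less[of i] by (intro even_less_8_cases) simp_all
  moreover have "2 * ix i + 1 \<in> {1, 3, 5, 7}" for i :: 4
    using ix_less[of i] by (intro odd_less_8_cases) simp_all
  ultimately have "(\<chi> i. m0 (w + shift (2 * ix i))) = (\<chi> i::4. m0 w)"
    and "(\<chi> i. m0 (w + shift (2 * ix i + 1))) = (\<chi> i::4. m0 (w + shift 1))"
    by (simp_all add: vec_eq_iff m0_even m0_odd del: insert_iff)
  then have weighted:
      "(\<chi> i. m0 (w + shift (2 * ix i))) v* Meven mt w = m0 w *s (\<Sum>i\<in>UNIV. Meven mt w $ i)"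
      "(\<chi> i. m0 (w + shift (2 * ix i + 1))) v* Modd mt w = m0 (w + shift 1) *s (\<Sum>i\<in>UNIV. Modd mt w $ i)"
    by (simp_all add: const_vector_matrix_mult)
  have "6 \<le> rank (Meven mt w) + rank (Modd mt w)"
    using rank6 vec_dim_Un_le[of "rows (Meven mt w)" "rows (Modd mt w)"]
    by (simp add: row_rank_def_gen rows_Mhat)
  moreover have "rank (Meven mt w) < 4" if "(\<Sum>i\<in>UNIV. Meven mt w $ i) = 0"
    using rank_less_if_rows_sum_zero[OF that] by simp
  moreover have "rank (Modd mt w) < 4" if "(\<Sum>i\<in>UNIV. Modd mt w $ i) = 0"
    using rank_less_if_rows_sum_zero[OF that] by simp
  ultimately show ?thesis
    unfolding range_subset_coset_sums_zero_iff weighted sum_rows_Meven sum_rows_Modd vector_mul_eq_0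
    using assms(4,5) by auto
qed

theorem proposition2:
  fixes m0 :: "real \<times> real \<Rightarrow> complex"
    and mt :: "nat \<Rightarrow> real \<times> real \<Rightarrow> complex"
  assumes per0: "periodic2 m0"
    and pert: "\<forall>j\<le>6. periodic2 (mt j)"
    and fullrank: "\<forall>w\<in>S0. rank (Mhat mt w) = 6"
    and sum1: "\<forall>w\<in>S0. (\<Sum>i\<in>{0,2,4,6::nat}. m0 w * cnj (mt 0 (w + shift i))) = 1"
  shows "(\<forall>w\<in>S0. \<exists>x::complex^6. Mhat mt w *v x = b0' m0 mt w)
     \<longleftrightarrow> (\<forall>w\<in>S0. rank (Modd mt w) = 3 \<and> rank (Meven mt w) = 3
           \<and> (\<chi> i. m0 (w + shift (2 * ix i))) v* Meven mt w = 0
           \<and> (\<chi> i. m0 (w + shift (2 * ix i + 1))) v* Modd mt w = 0)"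
    (is "?solvable \<longleftrightarrow> (\<forall>w\<in>S0. ?conditions w)")
proof -
  have per_mt0: "periodic2 (mt 0)"
    using pert by simp
  have rank6: "rank (Mhat mt w) = 6" for w
    using fullrank by (rule forall_S0_period_lattice) (simp add: Mhat_period[OF pert])
  have "\<forall>w\<in>S0. m0 w * even_shift_sum (mt 0) w = 1"
    using sum1 by (simp only: even_shift_sum_def sum_distrib_left)
  then have sum_eq_1: "m0 w * even_shift_sum (mt 0) w = 1" for w
    by (rule forall_S0_period_lattice)
      (simp add: even_shift_sum_period[OF per_mt0] periodic2_period_lattice[OF per0])
  note m0_even = m0_shift_even[of m0 "mt 0", OF sum_eq_1 per_mt0]
  note m0_odd = m0_shift_odd[of m0 "mt 0", OF sum_eq_1 per_mt0 per0]
  have m0_nonzero: "m0 w \<noteq> 0" for w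
    using sum_eq_1[of w] by auto
  have conditions_iff: "?conditions w \<longleftrightarrow> range ((*v) (Mhat mt w)) \<subseteq> coset_sums_zero" for w
    using rank_conditions_iff_range_subset[of mt w m0, OF rank6 m0_even m0_odd m0_nonzero m0_nonzero] .
  show ?thesis
  proof
    assume ?solvable
    then have solvable: "\<exists>x. Mhat mt w *v x = b0' m0 mt w" for w
      by (rule forall_S0_period_lattice) (simp add: Mhat_period[OF pert] b0'_period[where mt=mt, OF per0 per_mt0])
    have "range ((*v) (Mhat mt w)) = coset_sums_zero" for w
      by (rule range_Mhat_eq_if_solvable_at_shifts[of mt m0 w, OF pert m0_even m0_odd solvable])
    then show "\<forall>w\<in>S0. ?conditions w"
      unfolding conditions_iff by blast
  next
    assume "\<forall>w\<in>S0. ?conditions w"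
    then show ?solvable
      using solvable_if_range_subset[of mt _ m0, OF rank6 sum_eq_1] unfolding conditions_iff by blast
  qed
qed

end
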